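(* Let $W\ge 1$ be an integer and $0<\varepsilon<1$ be such that $W\varepsilon^{-1}=2^L$ for an integer $L$. Consider a window consisting of the last $W$ items of a stream over a universe of IDs, let $D$ be the number of distinct IDs in the window, and let $h$ be a random fingerprint function mapping IDs to $\{0,1,\dots,2^L-1\}$ such that the fingerprints of distinct IDs are independent and uniformly distributed. Let $Z$ be the number of distinct fingerprints among the items of the window, i.e. $Z=|\{h(y): y \text{ appears in the window}\}|$. Then $Z\le D$ always, and $\mathbb{E}(Z)\ge D\cdot\left(1-\frac{\varepsilon}{2}\right)$.
   Context: $Z$ is the quantity returned by the DistinctLB query of the SWAMP algorithm. *)

theory Defs
  imports "HOL-Probability.Probability"
begin

(* A stream is the list of the items that have arrived so far, the most recent one last.
   If fewer than W items have arrived, the window is the whole stream. *)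
definition window :: "nat \<Rightarrow> 'id list \<Rightarrow> 'id list" where
  "window W stream = drop (length stream - W) stream"

definition distinct_ids :: "nat \<Rightarrow> 'id list \<Rightarrow> nat" where
  "distinct_ids W stream = card (set (window W stream))"

definition distinct_fingerprints :: "('id \<Rightarrow> nat) \<Rightarrow> nat \<Rightarrow> 'id list \<Rightarrow> nat" where
  "distinct_fingerprints h W stream = card (h ` set (window W stream))"

(* The random function is given as a family of random variables h y, one per ID y in U.
   Independence is mutual. Measurability into the count space on {..<2 ^ L}, which is part
   of indep_vars, makes every h y take values in {..<2 ^ L} on the whole sample space. *)
definition random_fingerprint ::
    "'w measure \<Rightarrow> nat \<Rightarrow> 'id set \<Rightarrow> ('id \<Rightarrow> 'w \<Rightarrow> nat) \<Rightarrow> bool" where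
  "random_fingerprint M L U h \<longleftrightarrow>
     prob_space M \<and>
     prob_space.indep_vars M (\<lambda>_. count_space {..<2 ^ L}) h U \<and>
     (\<forall>y\<in>U. distr M (count_space {..<2 ^ L}) (h y) = uniform_count_measure {..<2 ^ L})"

end

theory Submission imports Defs begin

text \<open>
  Add the IDs of the window one at a time. A new ID fails to contribute a new fingerprint only
  if it collides with one of the \<open>k\<close> earlier IDs, and by the union bound this has probability
  at most \<open>k / 2 ^ L\<close>. Summing over \<open>k < D\<close>, the expected loss is at most
  \<open>D * (D - 1) / (2 * 2 ^ L)\<close>, and \<open>D - 1 \<le> W = \<epsilon> * 2 ^ L\<close>.
\<close>

text \<open>Pointwise form of the union bound. If \<open>f x\<close> is new, the cardinality grows
  by one and subtracting a nonnegative sum only weakens the bound; otherwise some summand equals 1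
  and cancels the \<open>+ 1\<close>.\<close>

lemma card_image_insert_ge:
  assumes "finite S"
  shows "real (card (f ` S)) + 1 - (\<Sum>y\<in>S. of_bool (f x = f y)) \<le> real (card (f ` insert x S))"
proof (cases "f x \<in> f ` S")
  case True
  then obtain y where y: "y \<in> S" "f x = f y" by auto
  have "(1::real) = of_bool (f x = f y)" using y by simp
  also have "\<dots> \<le> (\<Sum>y\<in>S. of_bool (f x = f y))"
    by (rule member_le_sum) (use y assms in auto)
  finally show ?thesis using True by (simp add: insert_absorb)
next
  case False
  have "0 \<le> (\<Sum>y\<in>S. of_bool (f x = f y) :: real)"
    by (rule sum_nonneg) auto
  with False show ?thesis using assms by simp
qed

lemma distinct_ids_le: "distinct_ids W stream \<le> W"
proof -
  have "card (set (window W stream)) \<le> length (window W stream)"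
    by (rule card_length)
  then show ?thesis
    by (simp add: distinct_ids_def window_def)
qed

context prob_space
begin

text \<open>The cardinality is a finite sum of indicators, one for each value in \<open>C\<close>,
  of the event that this value is hit. Integrability is what lets linearity and monotonicity of the
  expectation apply in the induction on \<open>S\<close> later.\<close>

lemma integrable_card_image:
  fixes h :: "'i \<Rightarrow> 'a \<Rightarrow> 'b"
  assumes "finite C" "finite S"
    and meas: "\<And>y. y \<in> S \<Longrightarrow> h y \<in> measurable M (count_space C)"
  shows "integrable M (\<lambda>\<omega>. real (card ((\<lambda>y. h y \<omega>) ` S)))"
proof -
  have pre: "{\<omega>\<in>space M. \<exists>y\<in>S. h y \<omega> = v} \<in> events" if "v \<in> C" for v
  proof -
    have "{\<omega>\<in>space M. \<exists>y\<in>S. h y \<omega> = v} = (\<Union>y\<in>S. h y -` {v} \<inter> space M)"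
      by auto
    also have "\<dots> \<in> events"
      using assms that by (intro sets.finite_UN measurable_sets[OF meas]) auto
    finally show ?thesis .
  qed
  have "integrable M (\<lambda>\<omega>. \<Sum>v\<in>C. indicat_real {\<omega>\<in>space M. \<exists>y\<in>S. h y \<omega> = v} \<omega>)"
    using pre by (intro Bochner_Integration.integrable_sum)
      (simp add: integrable_indicator_iff less_top[symmetric])
  also have "?this \<longleftrightarrow> ?thesis"
  proof (rule Bochner_Integration.integrable_cong[OF refl])
    fix \<omega> assume \<omega>: "\<omega> \<in> space M"
    \<comment> \<open>Measurability into \<open>count_space C\<close> confines the image to
      \<open>C\<close>, so summing over \<open>C\<close> counts every value that is hit.\<close>
    have sub: "(\<lambda>y. h y \<omega>) ` S \<subseteq> C"
      using measurable_space[OF meas \<omega>] by auto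
    have "(\<Sum>v\<in>C. indicat_real {\<omega>\<in>space M. \<exists>y\<in>S. h y \<omega> = v} \<omega>)
        = (\<Sum>v\<in>C. indicat_real ((\<lambda>y. h y \<omega>) ` S) v)"
      using \<omega> by (intro sum.cong refl) (auto simp: indicator_def)
    also have "\<dots> = real (card ((\<lambda>y. h y \<omega>) ` S))"
      using sub \<open>finite C\<close> by (simp add: indicator_def Int_absorb1)
    finally show "(\<Sum>v\<in>C. indicat_real {\<omega>\<in>space M. \<exists>y\<in>S. h y \<omega> = v} \<omega>)
        = real (card ((\<lambda>y. h y \<omega>) ` S))" .
  qed
  finally show ?thesis .
qed

text \<open>Split the collision by its common value: this gives \<open>card C\<close> disjoint
  events, each of probability \<open>1 / (card C)^2\<close> by independence and uniformity.\<close>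

lemma collision_event_and_prob:
  fixes h :: "'i \<Rightarrow> 'a \<Rightarrow> 'b"
  assumes "finite C" "C \<noteq> {}"
    and indep: "indep_vars (\<lambda>_. count_space C) h U"
    and unif: "\<And>y. y \<in> U \<Longrightarrow> distr M (count_space C) (h y) = uniform_count_measure C"
    and xy: "x \<in> U" "y \<in> U" "x \<noteq> y"
  shows "{\<omega>\<in>space M. h x \<omega> = h y \<omega>} \<in> events"
    and "prob {\<omega>\<in>space M. h x \<omega> = h y \<omega>} = 1 / real (card C)"
proof -
  have meas: "h z \<in> measurable M (count_space C)" if "z \<in> U" for z
    using indep that by (auto simp: indep_vars_def)
  have pt: "prob (h z -` {v} \<inter> space M) = 1 / real (card C)" if "z \<in> U" "v \<in> C" for z v
  proof -
    have "prob (h z -` {v} \<inter> space M) = measure (distr M (count_space C) (h z)) {v}"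
      using that by (intro measure_distr[symmetric] meas) auto
    also have "\<dots> = 1 / real (card C)"
      using that \<open>finite C\<close> by (simp add: unif measure_uniform_count_measure)
    finally show ?thesis .
  qed
  \<comment> \<open>Both variables take the value \<open>v\<close>; the event is written as an
    intersection over an index set because \<open>indep_varsD\<close> factors probabilities of that
    shape.\<close>
  define A where "A v = (\<Inter>z\<in>{x, y}. h z -` {v} \<inter> space M)" for v
  have A: "A v \<in> events" if "v \<in> C" for v
    unfolding A_def using that xy by (intro sets.finite_INT measurable_sets[OF meas]) auto
  have pA: "prob (A v) = 1 / real (card C) * (1 / real (card C))" if "v \<in> C" for v
  proof -
    have "prob (A v) = (\<Prod>z\<in>{x, y}. prob (h z -` {v} \<inter> space M))"
      unfolding A_def using that xy by (intro indep_varsD[OF indep]) auto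
    \<comment> \<open>Since \<open>x \<noteq> y\<close>, the product over \<open>{x, y}\<close> has
      two factors.\<close>
    then show ?thesis
      using that xy by (simp add: pt)
  qed
  have eq: "{\<omega>\<in>space M. h x \<omega> = h y \<omega>} = (\<Union>v\<in>C. A v)"
    using measurable_space[OF meas] xy by (auto simp: A_def)
  show "{\<omega>\<in>space M. h x \<omega> = h y \<omega>} \<in> events"
    unfolding eq using A \<open>finite C\<close> by auto
  have "prob (\<Union>v\<in>C. A v) = (\<Sum>v\<in>C. prob (A v))"
    using A \<open>finite C\<close> by (intro finite_measure_finite_Union) (auto simp: disjoint_family_on_def A_def)
  also have "\<dots> = 1 / real (card C)"
    using assms(1,2) by (simp add: pA)
  finally show "prob {\<omega>\<in>space M. h x \<omega> = h y \<omega>} = 1 / real (card C)"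
    unfolding eq .
qed

text \<open>The subtracted term is the sum of \<open>k / card C\<close> over
  \<open>k < card S\<close>: adding an element to a set of size \<open>k\<close> costs at most
  \<open>k / card C\<close> in expectation, which is the induction step.\<close>

lemma expectation_card_image_ge:
  fixes h :: "'i \<Rightarrow> 'a \<Rightarrow> 'b"
  assumes C: "finite C" "C \<noteq> {}"
    and indep: "indep_vars (\<lambda>_. count_space C) h U"
    and unif: "\<And>y. y \<in> U \<Longrightarrow> distr M (count_space C) (h y) = uniform_count_measure C"
    and "finite S" "S \<subseteq> U"
  shows "real (card S) - real (card S) * (real (card S) - 1) / (2 * real (card C))
    \<le> expectation (\<lambda>\<omega>. real (card ((\<lambda>y. h y \<omega>) ` S)))"
  using \<open>finite S\<close> \<open>S \<subseteq> U\<close>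
proof (induction S rule: finite_induct)
  case empty
  then show ?case by simp
next
  case (insert x S)
  let ?card = "\<lambda>S \<omega>. real (card ((\<lambda>y. h y \<omega>) ` S))"
  let ?E = "\<lambda>y. {\<omega>\<in>space M. h x \<omega> = h y \<omega>}"
  have meas: "h z \<in> measurable M (count_space C)" if "z \<in> U" for z
    using indep that by (auto simp: indep_vars_def)
  have int: "integrable M (?card T)" if "finite T" "T \<subseteq> U" for T
    using that by (intro integrable_card_image[OF C(1)] meas) auto
  have E: "?E y \<in> events" "prob (?E y) = 1 / real (card C)" if "y \<in> S" for y
  proof -
    have "x \<in> U" "y \<in> U" "x \<noteq> y" using that insert by auto
    then show "?E y \<in> events" "prob (?E y) = 1 / real (card C)"
      using collision_event_and_prob[OF C indep unif] by blast+
  qed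
  have intE: "integrable M (indicat_real (?E y))" if "y \<in> S" for y
    using E(1)[OF that] by (simp add: integrable_indicator_iff less_top[symmetric])
  \<comment> \<open>The induction hypothesis for \<open>S\<close>, plus the gain of 1 for
    \<open>x\<close>, minus the \<open>card S\<close> collision probabilities.\<close>
  have "real (card S) - real (card S) * (real (card S) - 1) / (2 * real (card C))
      + 1 - real (card S) / real (card C)
    \<le> expectation (?card S) + 1 - (\<Sum>y\<in>S. prob (?E y))"
    using insert E by simp
  also have "\<dots> = expectation (\<lambda>\<omega>. ?card S \<omega> + 1 - (\<Sum>y\<in>S. indicat_real (?E y) \<omega>))"
    using int[of S] intE insert E(1) by (simp add: prob_space)
  also have "\<dots> \<le> expectation (?card (insert x S))"
  proof (rule integral_mono)
    fix \<omega> assume \<omega>: "\<omega> \<in> space M"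
    \<comment> \<open>The events \<open>?E y\<close> are cut down to \<open>space M\<close>, so
      their indicators match the equality test only for points of that space.\<close>
    have "(\<Sum>y\<in>S. indicat_real (?E y) \<omega>) = (\<Sum>y\<in>S. of_bool (h x \<omega> = h y \<omega>))"
      using \<omega> by (intro sum.cong) auto
    then show "?card S \<omega> + 1 - (\<Sum>y\<in>S. indicat_real (?E y) \<omega>) \<le> ?card (insert x S) \<omega>"
      using card_image_insert_ge[OF insert.hyps(1), of "\<lambda>y. h y \<omega>" x] by simp
  qed (use int[of S] int[of "insert x S"] intE insert in auto)
  \<comment> \<open>The triangular recurrence \<open>n (n - 1) / 2 + n = (n + 1) n / 2\<close> with
    \<open>n = card S\<close>, divided by \<open>card C\<close>.\<close>
  moreover have "real (card S) * (real (card S) - 1) / (2 * real (card C)) + real (card S) / real (card C)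
    = (real (card S) + 1) * real (card S) / (2 * real (card C))"
    using C by (simp add: divide_simps) (simp add: algebra_simps)
  ultimately show ?case
    using insert.hyps by (simp add: add.commute)
qed

end

theorem theorem7:
  fixes W L :: nat and \<epsilon> :: real
    and U :: "'id set" and stream :: "'id list"
    and M :: "'w measure" and h :: "'id \<Rightarrow> 'w \<Rightarrow> nat"
    and D :: nat and Z :: "'w \<Rightarrow> nat"
  assumes "W \<ge> 1" and "0 < \<epsilon>" and "\<epsilon> < 1"
    and "real W * inverse \<epsilon> = 2 ^ L"
    and "set stream \<subseteq> U"
    and "random_fingerprint M L U h"
  defines "D \<equiv> distinct_ids W stream"
    and "Z \<equiv> \<lambda>\<omega>. distinct_fingerprints (\<lambda>y. h y \<omega>) W stream"
  shows "(\<forall>\<omega>\<in>space M. Z \<omega> \<le> D) \<and>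
    prob_space.expectation M (\<lambda>\<omega>. real (Z \<omega>)) \<ge> real D * (1 - \<epsilon> / 2)"
proof
  show "\<forall>\<omega>\<in>space M. Z \<omega> \<le> D"
    unfolding Z_def D_def distinct_fingerprints_def distinct_ids_def
    by (auto intro: card_image_le)
next
  let ?S = "set (window W stream)"
  interpret prob_space M
    using assms(6) by (simp add: random_fingerprint_def)
  have "?S \<subseteq> U"
    using assms(5) set_drop_subset[of _ stream] unfolding window_def by blast
  then have E: "real D - real D * (real D - 1) / (2 * 2 ^ L) \<le> expectation (\<lambda>\<omega>. real (Z \<omega>))"
    using assms(6) expectation_card_image_ge[of "{..<2 ^ L}" h U ?S]
    by (simp add: random_fingerprint_def D_def Z_def distinct_ids_def distinct_fingerprints_def
        lessThan_empty_iff)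
  have W: "real W = \<epsilon> * 2 ^ L"
    using assms(2,4) by (simp add: field_simps)
  \<comment> \<open>From \<open>D - 1 \<le> D \<le> W\<close>. Substituting
    \<open>W = \<epsilon> * 2 ^ L\<close> then cancels the \<open>2 ^ L\<close> in the loss term and
    leaves \<open>D * \<epsilon> / 2\<close>.\<close>
  have "real D * (real D - 1) \<le> real D * real W"
    using distinct_ids_le[of W stream] by (intro mult_left_mono) (auto simp: D_def)
  then have "real D * (real D - 1) / (2 * 2 ^ L) \<le> real D * \<epsilon> / 2"
    unfolding W by (simp add: field_simps)
  moreover have "real D * (1 - \<epsilon> / 2) = real D - real D * \<epsilon> / 2"
    by (simp add: algebra_simps)
  ultimately show "real D * (1 - \<epsilon> / 2) \<le> expectation (\<lambda>\<omega>. real (Z \<omega>))"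
    using E by linarith
qed

end
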